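(* Let $k\geq 2$ be an integer, let $r_1,\dots,r_k$ be positive integers, and consider any $(k+1)$-colouring of the edges of $\vec{K}_{\mathbb{N}}$ using colours $c_1,\dots,c_{k+1}$. Suppose that, for every $t\in\{1,\dots,k\}$, there is no $c_t$-coloured directed path of length $r_t$. Then there exists a directed path of colour $c_{k+1}$ with upper density at least $\prod_{t=1}^{k}\frac{1}{r_t}$.
   Context: $\mathbb{N}$ denotes the set of positive integers. $\vec{K}_{\mathbb{N}}$ is the complete symmetric digraph on $\mathbb{N}$: its vertex set is $\mathbb{N}$ and for every pair of distinct $m,n\in\mathbb{N}$ both directed edges $(m,n)$ (from $m$ to $n$) and $(n,m)$ are present. A $(k+1)$-colouring of $\vec{K}_{\mathbb{N}}$ is an assignment of one of $k+1$ colours to each directed edge (so $(m,n)$ and $(n,m)$ may receive different colours). A path $P=v_1v_2\dots$ in $\vec{K}_{\mathbb{N}}$ is a finite or (one-way) infinite sequence of distinct vertices together with, for each pair of consecutive vertices, one of the two directed edges joining them. $P$ is a directed path if all its edges are oriented in the same direction along $P$. The length of a path is its number of edges. A path is $c$-coloured (of colour $c$) if all of its edges have colour $c$. The upper density of a set $A\subseteq\mathbb{N}$ is $\bar d(A)=\limsup_{n\to\infty}\frac{|A\cap\{1,\dots,n\}|}{n}$, and the upper density of a path is the upper density of its vertex set. *)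

theory Defs
  imports
    "HOL-Library.Extended_Real"
    "HOL-Library.FuncSet"
    "Graph_Theory.Pair_Digraph"
begin

definition complete_sym_digraph_N :: "nat pair_pre_digraph" where
  "complete_sym_digraph_N =
     \<lparr> pverts = {1..}, parcs = {(m, n). m \<ge> 1 \<and> n \<ge> 1 \<and> m \<noteq> n} \<rparr>"

text \<open>
  A (not necessarily directed) path is a finite or one-way infinite vertex sequence together with a
  choice of edge between consecutive vertices. The vertices are the \<open>pvertex P i\<close> with
  \<open>i \<le> plength P\<close>, and the edge between vertices \<open>i\<close> and \<open>i + 1\<close> is \<open>pedge P i\<close> for
  \<open>i < plength P\<close>; values at larger indices are irrelevant. The length, i.e. the number of edges,
  is \<open>\<infinity>\<close> for an infinite path.
\<close>

record 'a seq_path =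
  plength :: enat
  pvertex :: "nat \<Rightarrow> 'a"
  pedge :: "nat \<Rightarrow> 'a \<times> 'a"

definition path_verts :: "'a seq_path \<Rightarrow> 'a set" where
  "path_verts P = pvertex P ` {i. enat i \<le> plength P}"

definition path_arcs :: "'a seq_path \<Rightarrow> ('a \<times> 'a) set" where
  "path_arcs P = pedge P ` {i. enat i < plength P}"

definition is_path :: "'a pair_pre_digraph \<Rightarrow> 'a seq_path \<Rightarrow> bool" where
  "is_path G P \<longleftrightarrow>
     path_verts P \<subseteq> pverts G \<and> path_arcs P \<subseteq> parcs G \<and>
     inj_on (pvertex P) {i. enat i \<le> plength P} \<and>
     (\<forall>i. enat i < plength P \<longrightarrow>
        pedge P i = (pvertex P i, pvertex P (Suc i)) \<or>
        pedge P i = (pvertex P (Suc i), pvertex P i))"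

text \<open>
  All edges may point forwards or all may point backwards along the sequence. For infinite paths
  these are different: \<open>v\<^sub>1 \<rightarrow> v\<^sub>2 \<rightarrow> \<dots>\<close> has an initial vertex and \<open>v\<^sub>1 \<leftarrow> v\<^sub>2 \<leftarrow> \<dots>\<close> a final one.
\<close>

definition is_directed_path :: "'a pair_pre_digraph \<Rightarrow> 'a seq_path \<Rightarrow> bool" where
  "is_directed_path G P \<longleftrightarrow> is_path G P \<and>
     ((\<forall>i. enat i < plength P \<longrightarrow> pedge P i = (pvertex P i, pvertex P (Suc i))) \<or>
      (\<forall>i. enat i < plength P \<longrightarrow> pedge P i = (pvertex P (Suc i), pvertex P i)))"

definition path_coloured :: "('a \<times> 'a \<Rightarrow> 'c) \<Rightarrow> 'c \<Rightarrow> 'a seq_path \<Rightarrow> bool" where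
  "path_coloured \<chi> c P \<longleftrightarrow> (\<forall>e\<in>path_arcs P. \<chi> e = c)"

definition upper_density :: "nat set \<Rightarrow> ereal" where
  "upper_density A = limsup (\<lambda>n. ereal (real (card (A \<inter> {1..n})) / real n))"

end

theory Submission
  imports Defs
begin

text \<open>
  A digraph without directed paths of length \<open>r\<close> is \<open>r\<close>-colourable: this is the theorem of Gallai
  and Roy (\<open>gallai_roy\<close>). Applied to the digraph of the edges of colour \<open>c t\<close>, for each
  \<open>t \<in> {1..k}\<close>, it gives a labelling \<open>h t\<close> of the vertices by numbers less than \<open>r t\<close> under which the ends
  of an edge of colour \<open>c t\<close> have distinct labels. The vertices are thus split into at most
  \<open>\<Prod>t=1..k. r t\<close> classes on which every \<open>h t\<close> is constant. Inside a class no edge has a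
  colour among \<open>c 1, \<dots>, c k\<close>, so every edge in either direction has colour \<open>c (k + 1)\<close>.

  Upper density is subadditive, so one of the classes has upper density at least
  \<open>\<Prod>t=1..k. 1 / r t\<close> (\<open>upper_density_pigeonhole\<close>). It is infinite because this bound is
  positive, and listing its elements in increasing order gives the required path.
\<close>

section \<open>The Gallai-Roy theorem\<close>

text \<open>
  A cycle is finite, so a cycle in the union of a chain of relations lies in one member of the
  chain; this is what makes Zorn's lemma applicable.
\<close>

lemma maximal_acyclic_subset_exists:
  "\<exists>D. D \<subseteq> E \<and> acyclic D \<and> (\<forall>X. X \<subseteq> E \<longrightarrow> acyclic X \<longrightarrow> D \<subseteq> X \<longrightarrow> X = D)"
proof -
  let ?F = "{D. D \<subseteq> E \<and> acyclic D}"
  have "\<exists>U\<in>?F. \<forall>X\<in>C. X \<subseteq> U" if C: "subset.chain ?F C" for C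
  proof (cases "C = {}")
    case True
    then show ?thesis by (auto simp: acyclic_def intro!: exI[of _ "{}"])
  next
    case False
    have "\<exists>R\<in>C. (x, y) \<in> R\<^sup>+" if "(x, y) \<in> (\<Union>C)\<^sup>+" for x y
      using that
    proof (induction rule: trancl_induct)
      case (base y)
      then show ?case by blast
    next
      case (step y z)
      then obtain R S where RS: "R \<in> C" "(x, y) \<in> R\<^sup>+" "S \<in> C" "(y, z) \<in> S"
        by blast
      then consider "R \<subseteq> S" | "S \<subseteq> R"
        using C unfolding subset_chain_def by blast
      then show ?case
      proof cases
        case 1
        then have "(x, y) \<in> S\<^sup>+" using RS trancl_mono by blast
        then show ?thesis using RS by (meson trancl.trancl_into_trancl)
      next
        case 2
        then show ?thesis using RS by (meson subsetD trancl.trancl_into_trancl)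
      qed
    qed
    moreover have "C \<subseteq> ?F" using C by (simp add: subset_chain_def)
    ultimately have "\<Union>C \<in> ?F" unfolding acyclic_def by blast
    then show ?thesis by blast
  qed
  then have "\<exists>M\<in>?F. \<forall>X\<in>?F. M \<subseteq> X \<longrightarrow> X = M"
    by (intro subset_Zorn) auto
  then show ?thesis by (simp add: Bex_def Ball_def conj_assoc imp_conjL)
qed

text \<open>
  Labelling a vertex by the length of a longest path ending there works for acyclic digraphs only.
  The labels are therefore taken with respect to a maximal acyclic subset \<open>D\<close> of the edges, and they
  increase along \<open>D\<close>. An edge \<open>(u, v)\<close> outside \<open>D\<close> closes a cycle with \<open>D\<close>, so
  \<open>D\<close> has a path from \<open>v\<close> to \<open>u\<close>, and again the two labels differ.
\<close>

lemma gallai_roy: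
  fixes E :: "('a \<times> 'a) set" and r :: nat
  assumes irr: "\<And>v. (v, v) \<notin> E"
    and no_path: "\<And>f :: nat \<Rightarrow> 'a. inj_on f {..r} \<Longrightarrow> \<forall>i<r. (f i, f (Suc i)) \<in> E \<Longrightarrow> False"
  obtains h :: "'a \<Rightarrow> nat"
  where "\<And>v. h v < r" and "\<And>u v. (u, v) \<in> E \<Longrightarrow> h u \<noteq> h v"
proof -
  obtain D where D: "D \<subseteq> E" "acyclic D"
    and max: "\<And>X. X \<subseteq> E \<Longrightarrow> acyclic X \<Longrightarrow> D \<subseteq> X \<Longrightarrow> X = D"
    using maximal_acyclic_subset_exists[of E] by blast
  define L where "L v = {n. \<exists>u. (u, v) \<in> D ^^ n}" for v
  have short: "n < r" if n: "n \<in> L v" for n v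
  proof (rule ccontr)
    assume "\<not> n < r"
    obtain u where "(u, v) \<in> D ^^ n" using n unfolding L_def by blast
    then obtain f where f: "\<And>i. i < n \<Longrightarrow> (f i, f (Suc i)) \<in> D"
      unfolding relpow_fun_conv by metis
    have walk: "(f i, f j) \<in> D\<^sup>+" if "i < j" "j \<le> n" for i j
      using that
    proof (induction j)
      case (Suc j)
      show ?case
      proof (cases "i = j")
        case True
        then show ?thesis using f[of j] Suc.prems by auto
      next
        case False
        then have "(f i, f j) \<in> D\<^sup>+" using Suc by simp
        then show ?thesis using f[of j] Suc.prems by (meson Suc_le_lessD trancl.trancl_into_trancl)
      qed
    qed simp
    have "f i \<noteq> f j" if "i < j" "j \<le> r" for i j
      using walk[of i j] that \<open>\<not> n < r\<close> D(2) by (auto simp: acyclic_def)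
    then have "inj_on f {..r}" by (intro linorder_inj_onI) auto
    moreover have "\<forall>i<r. (f i, f (Suc i)) \<in> E"
      using f \<open>\<not> n < r\<close> D(1) by auto
    ultimately show False by (rule no_path)
  qed
  have fin: "finite (L v)" for v
    by (rule finite_subset[of _ "{..<r}"]) (auto dest: short)
  have "0 \<in> L v" for v by (auto simp: L_def)
  then have ne: "L v \<noteq> {}" for v by blast
  define h where "h v = Max (L v)" for v
  have hL: "h v \<in> L v" for v unfolding h_def using fin ne by (rule Max_in)
  have step: "h u < h v" if "(u, v) \<in> D" for u v
  proof -
    have "Suc (h u) \<in> L v" using hL[of u] that by (auto simp: L_def)
    then show ?thesis using Max_ge[OF fin] unfolding h_def by (meson Suc_le_lessD)
  qed
  have mono: "h u < h v" if "(u, v) \<in> D\<^sup>+" for u v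
    using that by (induction rule: trancl_induct) (auto dest: step)
  have "h u \<noteq> h v" if e: "(u, v) \<in> E" for u v
  proof (cases "(u, v) \<in> D")
    case True
    then show ?thesis using step by fastforce
  next
    case False
    then have "\<not> acyclic (insert (u, v) D)"
      using max[of "insert (u, v) D"] D e by blast
    then have "(v, u) \<in> D\<^sup>*" using D(2) by simp
    moreover have "u \<noteq> v" using e irr by blast
    ultimately have "(v, u) \<in> D\<^sup>+" by (metis rtranclD)
    then show ?thesis using mono by fastforce
  qed
  then show thesis using that[of h] short[OF hL] by blast
qed

section \<open>Upper density\<close>

lemma upper_density_finite:
  assumes "finite A"
  shows "upper_density A = 0"
proof -
  have "(\<lambda>n. real (card (A \<inter> {1..n})) / real n) \<longlonglongrightarrow> 0"
  proof (rule tendsto_sandwich[where f = "\<lambda>_. 0"])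
    show "\<forall>\<^sub>F n in sequentially. real (card (A \<inter> {1..n})) / real n \<le> real (card A) / real n"
      using assms by (intro always_eventually allI divide_right_mono) (auto intro: card_mono)
    show "(\<lambda>n. real (card A) / real n) \<longlonglongrightarrow> 0"
      by (rule lim_const_over_n)
  qed auto
  then have "(\<lambda>n. ereal (real (card (A \<inter> {1..n})) / real n)) \<longlonglongrightarrow> 0"
    by (simp add: zero_ereal_def)
  then show ?thesis unfolding upper_density_def by (intro lim_imp_Limsup) auto
qed

text \<open>
  If every class had upper density below \<open>1 / card I\<close>, then for some large \<open>n\<close> every class would
  contain fewer than \<open>n / card I\<close> of the numbers \<open>1, \<dots>, n\<close>, which the classes together exhaust.
\<close>

lemma upper_density_pigeonhole:
  fixes f :: "nat \<Rightarrow> 'i"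
  assumes fin: "finite I" and f: "\<And>v. v \<ge> 1 \<Longrightarrow> f v \<in> I"
  obtains i where "i \<in> I" "upper_density {v. v \<ge> 1 \<and> f v = i} \<ge> ereal (1 / real (card I))"
proof -
  define A where "A i = {v. v \<ge> 1 \<and> f v = i}" for i
  have ne: "I \<noteq> {}" using f[of 1] by auto
  have "\<exists>i\<in>I. upper_density (A i) \<ge> ereal (1 / real (card I))"
  proof (rule ccontr)
    assume "\<not> ?thesis"
    then have "\<forall>i\<in>I. \<forall>\<^sub>F n in sequentially.
        ereal (real (card (A i \<inter> {1..n})) / real n) < ereal (1 / real (card I))"
      unfolding upper_density_def by (intro ballI Limsup_lessD) (auto simp: not_le)
    then have "\<forall>\<^sub>F n in sequentially. \<forall>i\<in>I.
        real (card (A i \<inter> {1..n})) / real n < 1 / real (card I)"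
      using fin by (simp add: eventually_ball_finite_distrib)
    then have "\<forall>\<^sub>F n in sequentially. n \<ge> 1 \<and> (\<forall>i\<in>I.
        real (card (A i \<inter> {1..n})) / real n < 1 / real (card I))"
      by (intro eventually_conj eventually_ge_at_top)
    then obtain n where n: "n \<ge> 1"
      and small: "\<And>i. i \<in> I \<Longrightarrow> real (card (A i \<inter> {1..n})) / real n < 1 / real (card I)"
      unfolding eventually_sequentially by blast
    have "{1..n} = (\<Union>i\<in>I. A i \<inter> {1..n})"
      using f by (auto simp: A_def)
    then have "n = card (\<Union>i\<in>I. A i \<inter> {1..n})" by (metis card_atLeastAtMost diff_Suc_1)
    also have "\<dots> = (\<Sum>i\<in>I. card (A i \<inter> {1..n}))"
      using fin by (intro card_UN_disjoint) (auto simp: A_def)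
    finally have "real n = (\<Sum>i\<in>I. real (card (A i \<inter> {1..n})))" by (metis of_nat_sum)
    then have "1 = (\<Sum>i\<in>I. real (card (A i \<inter> {1..n})) / real n)"
      using n by (simp add: sum_divide_distrib[symmetric])
    also have "\<dots> < (\<Sum>i\<in>I. 1 / real (card I))"
      using fin ne small by (intro sum_strict_mono) auto
    also have "\<dots> = 1" using fin ne by simp
    finally show False by simp
  qed
  then show thesis using that unfolding A_def by blast
qed

section \<open>Monochromatic paths\<close>

text \<open>
  This reduces the conditions on the path records to conditions on the vertex sequence alone. It
  serves both the finite paths that colours \<open>c 1, \<dots>, c k\<close> exclude and the infinite path that
  is to be found.
\<close>

lemma forward_path:
  fixes f :: "nat \<Rightarrow> nat" and l :: enat
  assumes "inj_on f {i. enat i \<le> l}"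
    and "\<And>i. enat i \<le> l \<Longrightarrow> f i \<ge> 1"
    and "\<And>i. enat i < l \<Longrightarrow> \<chi> (f i, f (Suc i)) = c"
  defines "P \<equiv> \<lparr>plength = l, pvertex = f, pedge = \<lambda>i. (f i, f (Suc i))\<rparr>"
  shows "is_directed_path complete_sym_digraph_N P" and "path_coloured \<chi> c P"
proof -
  have "(f i, f (Suc i)) \<in> parcs complete_sym_digraph_N" if "enat i < l" for i
  proof -
    have "enat i \<le> l" "enat (Suc i) \<le> l" using that by (simp_all add: Suc_ile_eq)
    then show ?thesis
      using assms(1,2) by (auto simp: complete_sym_digraph_N_def dest: inj_onD)
  qed
  then show "is_directed_path complete_sym_digraph_N P"
    using assms(1,2)
    by (auto simp: P_def is_directed_path_def is_path_def path_verts_def path_arcs_def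
        complete_sym_digraph_N_def)
  show "path_coloured \<chi> c P"
    using assms(3) by (auto simp: P_def path_coloured_def path_arcs_def)
qed

lemma infinite_monochromatic_clique_path:
  assumes "infinite A" and "\<And>v. v \<in> A \<Longrightarrow> v \<ge> (1 :: nat)"
    and "\<And>u v. u \<in> A \<Longrightarrow> v \<in> A \<Longrightarrow> u \<noteq> v \<Longrightarrow> \<chi> (u, v) = c"
  obtains P where "is_directed_path complete_sym_digraph_N P" "path_coloured \<chi> c P"
    "path_verts P = A"
proof
  let ?f = "enumerate A"
  let ?P = "\<lparr>plength = \<infinity>, pvertex = ?f, pedge = \<lambda>i. (?f i, ?f (Suc i))\<rparr>"
  have inj: "inj ?f" using assms(1) by (simp add: inj_enumerate)
  have inA: "?f i \<in> A" for i using assms(1) by (rule enumerate_in_set)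
  have col: "\<chi> (?f i, ?f (Suc i)) = c" for i
    using assms(3) inA injD[OF inj, of i "Suc i"] by fastforce
  show "is_directed_path complete_sym_digraph_N ?P" "path_coloured \<chi> c ?P"
    using inj assms(2) inA col by (auto intro!: forward_path)
  show "path_verts ?P = A"
    using range_enumerate[OF assms(1)] by (simp add: path_verts_def)
qed

theorem theorem1p5:
  fixes k :: nat and r :: "nat \<Rightarrow> nat" and c :: "nat \<Rightarrow> 'c"
    and \<chi> :: "nat \<times> nat \<Rightarrow> 'c"
  assumes "k \<ge> 2"
    and "\<And>t. t \<in> {1..k} \<Longrightarrow> r t \<ge> 1"
    and "inj_on c {1..k + 1}"
    and "\<chi> \<in> parcs complete_sym_digraph_N \<rightarrow> c ` {1..k + 1}"
    and "\<And>t. t \<in> {1..k} \<Longrightarrow>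
           \<not> (\<exists>P. is_directed_path complete_sym_digraph_N P \<and>
                  path_coloured \<chi> (c t) P \<and> plength P = enat (r t))"
  shows "\<exists>P. is_directed_path complete_sym_digraph_N P \<and>
             path_coloured \<chi> (c (k + 1)) P \<and>
             upper_density (path_verts P) \<ge> ereal (\<Prod>t=1..k. 1 / real (r t))"
proof -
  have "\<forall>t\<in>{1..k}. \<exists>h. (\<forall>v. h v < r t) \<and>
      (\<forall>u v. u \<ge> 1 \<longrightarrow> v \<ge> 1 \<longrightarrow> u \<noteq> v \<longrightarrow> \<chi> (u, v) = c t \<longrightarrow> h u \<noteq> h v)"
  proof
    fix t
    assume t: "t \<in> {1..k}"
    define E where "E = {(u, v). u \<ge> 1 \<and> v \<ge> 1 \<and> u \<noteq> v \<and> \<chi> (u, v) = c t}"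
    have no_path: False if inj: "inj_on f {..r t}" and E: "\<forall>i<r t. (f i, f (Suc i)) \<in> E" for f
    proof -
      let ?P = "\<lparr>plength = enat (r t), pvertex = f, pedge = \<lambda>i. (f i, f (Suc i))\<rparr>"
      have pos: "f i \<ge> 1" if "i \<le> r t" for i
      proof (cases "i < r t")
        case True
        then show ?thesis using E by (auto simp: E_def)
      next
        \<comment> \<open>The last vertex is the head of the last edge, which exists because \<open>r t \<ge> 1\<close>.\<close>
        case False
        then have "i = Suc (r t - 1)" "r t - 1 < r t" using that assms(2)[OF t] by auto
        then show ?thesis using E by (auto simp: E_def)
      qed
      have "is_directed_path complete_sym_digraph_N ?P" "path_coloured \<chi> (c t) ?P"
        using inj pos E by (auto intro!: forward_path simp: E_def atMost_def)
      moreover have "plength ?P = enat (r t)" by simp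
      ultimately show False using assms(5)[OF t] by blast
    qed
    have "(v, v) \<notin> E" for v by (simp add: E_def)
    then obtain h where "\<And>v. h v < r t" "\<And>u v. (u, v) \<in> E \<Longrightarrow> h u \<noteq> h v"
      using gallai_roy[of E "r t"] no_path by blast
    then show "\<exists>h. (\<forall>v. h v < r t) \<and>
        (\<forall>u v. u \<ge> 1 \<longrightarrow> v \<ge> 1 \<longrightarrow> u \<noteq> v \<longrightarrow> \<chi> (u, v) = c t \<longrightarrow> h u \<noteq> h v)"
      by (intro exI[of _ h]) (simp add: E_def)
  qed
  from bchoice[OF this] obtain h where h: "\<And>t v. t \<in> {1..k} \<Longrightarrow> h t v < r t"
    and proper: "\<And>t u v. t \<in> {1..k} \<Longrightarrow> u \<ge> 1 \<Longrightarrow> v \<ge> 1 \<Longrightarrow> u \<noteq> v \<Longrightarrow> \<chi> (u, v) = c t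
      \<Longrightarrow> h t u \<noteq> h t v"
    by blast
  define I where "I = (\<Pi>\<^sub>E t\<in>{1..k}. {..<r t})"
  define f where "f v = (\<lambda>t\<in>{1..k}. h t v)" for v
  have "finite I" unfolding I_def by (intro finite_PiE) auto
  moreover have "f v \<in> I" for v unfolding f_def I_def using h by auto
  \<comment> \<open>The labels \<open>h 1, \<dots>, h k\<close> together are a labelling by \<open>I\<close>, whose cardinality is the product.\<close>
  ultimately obtain x where
    dens: "upper_density {v. v \<ge> 1 \<and> f v = x} \<ge> ereal (1 / real (card I))"
    using upper_density_pigeonhole by metis
  define A where "A = {v. v \<ge> 1 \<and> f v = x}"
  have "1 / real (card I) = (\<Prod>t=1..k. 1 / real (r t))"
    by (simp add: I_def card_PiE prod_dividef)
  with dens have dens': "upper_density A \<ge> ereal (\<Prod>t=1..k. 1 / real (r t))"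
    by (simp add: A_def)
  have "(\<Prod>t=1..k. 1 / real (r t)) > 0"
    using assms(2) by (intro prod_pos) (simp add: Suc_le_eq)
  then have "upper_density A \<noteq> 0" using dens' by (auto simp: zero_ereal_def)
  then have "infinite A" using upper_density_finite by blast
  moreover have "\<chi> (u, v) = c (k + 1)" if uv: "u \<in> A" "v \<in> A" "u \<noteq> v" for u v
  proof -
    have "(u, v) \<in> parcs complete_sym_digraph_N"
      using uv by (auto simp: A_def complete_sym_digraph_N_def)
    then obtain t where t: "t \<in> {1..k + 1}" "\<chi> (u, v) = c t" using assms(4) by blast
    have "t \<notin> {1..k}"
    proof
      assume "t \<in> {1..k}"
      moreover have "f u t = f v t" using uv by (simp add: A_def)
      ultimately have "h t u = h t v" by (simp add: f_def)
      then show False using proper[OF \<open>t \<in> {1..k}\<close> _ _ uv(3)] t(2) uv(1,2) by (simp add: A_def)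
    qed
    then have "t = k + 1" using t by auto
    then show ?thesis using t by simp
  qed
  ultimately obtain P where "is_directed_path complete_sym_digraph_N P"
      "path_coloured \<chi> (c (k + 1)) P" "path_verts P = A"
    using infinite_monochromatic_clique_path[of A \<chi> "c (k + 1)"] by (auto simp: A_def)
  then show ?thesis using dens' by blast
qed

end
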